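(* Let $T>0$, let $\Omega\subset\mathbb{R}^m$ be compact, let $\Gamma\subset\Omega$ be closed with $\Omega\setminus\Gamma$ open in $\mathbb{R}^m$, let $P:\Omega\setminus\Gamma\to[0,\infty)$ and $\psi:\Omega\to\mathbb{R}$ be Lipschitz continuous. Assume that there exist $a_0,d_0>0$ such that, with $\mathcal{N}=\{x\in\Omega:\ d(x,\Gamma)<a_0\}$, the function $d(\cdot,\Gamma)$ is $C^1$ on $\mathcal{N}\setminus\Gamma$ and $|\nabla d(x,\Gamma)|\ge d_0$ for all $x\in\mathcal{N}\setminus\Gamma$. Assume also that there exists a Lipschitz function $\psi_b:\Omega\to\mathbb{R}$ with $\psi_b=\psi$ on $\Gamma$ such that $(x,t)\mapsto\psi_b(x)$ is a viscosity sub-solution of problem $(\mathcal{P})$ in $\Omega_T$. Then the unique (continuous) viscosity solution $f$ of $(\mathcal{P})$ satisfies: (1) for every $x\in\Omega$, $f(x,\cdot)$ is Lipschitz continuous on $[0,T)$ with Lipschitz constant $L_{f(x,\cdot)}\le\|P\|_{L^\infty(\Omega\setminus\Gamma)}+L_\psi$; (2) for every $t\in[0,T]$, $f(\cdot,t)$ is Lipschitz continuous on $\Omega$ with Lipschitz constant $L_{f(\cdot,t)}\le 2\|P\|_{L^\infty(\Omega\setminus\Gamma)}+L_\psi$.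
   Context: $|\cdot|$ is the Euclidean norm on $\mathbb{R}^m$; $d(x,\Gamma)=\min_{z\in\Gamma}|x-z|$; $L_h$ is the Lipschitz constant of a Lipschitz function $h$; $\|\cdot\|_{L^\infty(\Sigma)}$ is the supremum norm on $\Sigma$. Set $\Omega_T=\Omega\times[0,T]$ and $\partial\Omega_T=(\Gamma\times(0,T))\cup(\Omega\times\{0\})$. Problem $(\mathcal{P})$ is: $\partial_t f(x,t)=-|\nabla f(x,t)|+P(x)$ for $(x,t)\in(\Omega\setminus\Gamma)\times(0,T)$, and $f(x,t)=\psi(x)$ for $(x,t)\in\partial\Omega_T$. Viscosity solutions. An upper semicontinuous $f:\Omega_T\to\mathbb{R}$ is a viscosity sub-solution of $(\mathcal{P})$ in $(\Omega\setminus\Gamma)\times(0,T)$ if for every $\varphi\in C^1((\Omega\setminus\Gamma)\times(0,T))$ such that $f-\varphi$ has a local maximum at $(x_0,t_0)\in(\Omega\setminus\Gamma)\times(0,T)$ one has $\partial_t\varphi(x_0,t_0)\le-|\nabla\varphi(x_0,t_0)|+P(x_0)$; it is a viscosity sub-solution in $\Omega_T$ if moreover $f(x,t)\le\psi(x)$ for all $(x,t)\in\partial\Omega_T$. A lower semicontinuous $f:\Omega_T\to\mathbb{R}$ is a viscosity super-solution in $(\Omega\setminus\Gamma)\times(0,T)$ if for every such $\varphi$ with $f-\varphi$ having a local minimum at $(x_0,t_0)$ one has $\partial_t\varphi(x_0,t_0)\ge-|\nabla\varphi(x_0,t_0)|+P(x_0)$; it is a viscosity super-solution in $\Omega_T$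 if moreover $f(x,t)\ge\psi(x)$ on $\partial\Omega_T$. A locally bounded $f:\Omega_T\to\mathbb{R}$ is a viscosity solution in $\Omega_T$ if its upper semicontinuous envelope $f^*(x,t)=\limsup_{(y,s)\to(x,t)}f(y,s)$ is a viscosity sub-solution in $\Omega_T$ and its lower semicontinuous envelope $f_*(x,t)=\liminf_{(y,s)\to(x,t)}f(y,s)$ is a viscosity super-solution in $\Omega_T$. Under the stated hypotheses $(\mathcal{P})$ has a unique continuous viscosity solution on $\Omega_T$, which is the $f$ of the claim. *)

theory Defs
  imports "HOL-Analysis.Analysis"
begin

definition lipschitz_fun_on :: "'a::metric_space set \<Rightarrow> ('a \<Rightarrow> 'b::metric_space) \<Rightarrow> bool"
  where "lipschitz_fun_on S h \<longleftrightarrow> (\<exists>L. L-lipschitz_on S h)"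

(* The least Lipschitz constant L_h; meaningful only if lipschitz_fun_on S h. *)
definition lip_const :: "'a::metric_space set \<Rightarrow> ('a \<Rightarrow> 'b::metric_space) \<Rightarrow> real"
  where "lip_const S h = Inf {L. L-lipschitz_on S h}"

(* Inserting 0 only matters for S = {}, where Sup {} :: real carries no information. *)
definition sup_norm_on :: "'a set \<Rightarrow> ('a \<Rightarrow> real) \<Rightarrow> real"
  where "sup_norm_on S h = Sup (insert 0 ((\<lambda>x. \<bar>h x\<bar>) ` S))"

definition grad :: "('a::real_inner \<Rightarrow> real) \<Rightarrow> 'a \<Rightarrow> 'a"
  where "grad h x = (THE D. GDERIV h x :> D)"

(* Intended for open U, since GDERIV is the two-sided derivative. *)
definition C1_on :: "'a::real_inner set \<Rightarrow> ('a \<Rightarrow> real) \<Rightarrow> bool"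
  where "C1_on U h \<longleftrightarrow> (\<exists>G. (\<forall>x\<in>U. GDERIV h x :> G x) \<and> continuous_on U G)"

definition usc_on :: "'a::topological_space set \<Rightarrow> ('a \<Rightarrow> real) \<Rightarrow> bool"
  where "usc_on S h \<longleftrightarrow> (\<forall>z\<in>S. \<forall>c>h z. \<forall>\<^sub>F w in at z within S. h w < c)"

definition lsc_on :: "'a::topological_space set \<Rightarrow> ('a \<Rightarrow> real) \<Rightarrow> bool"
  where "lsc_on S h \<longleftrightarrow> (\<forall>z\<in>S. \<forall>c<h z. \<forall>\<^sub>F w in at z within S. c < h w)"

definition locally_bounded_on :: "'a::metric_space set \<Rightarrow> ('a \<Rightarrow> real) \<Rightarrow> bool"
  where "locally_bounded_on S h \<longleftrightarrow> (\<forall>z\<in>S. \<exists>r>0. bounded (h ` (ball z r \<inter> S)))"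

(* Envelopes relative to S. As usual for semicontinuous envelopes, the upper and lower limits
   range over neighbourhoods including the point z itself. They are finite, so that
   real_of_ereal is harmless, whenever h is locally bounded on S. *)
definition usc_envelope :: "'a::topological_space set \<Rightarrow> ('a \<Rightarrow> real) \<Rightarrow> 'a \<Rightarrow> real"
  where "usc_envelope S h z =
    real_of_ereal (Limsup (inf (nhds z) (principal S)) (\<lambda>w. ereal (h w)))"

definition lsc_envelope :: "'a::topological_space set \<Rightarrow> ('a \<Rightarrow> real) \<Rightarrow> 'a \<Rightarrow> real"
  where "lsc_envelope S h z =
    real_of_ereal (Liminf (inf (nhds z) (principal S)) (\<lambda>w. ereal (h w)))"

definition local_max_at :: "'a::topological_space set \<Rightarrow> ('a \<Rightarrow> real) \<Rightarrow> 'a \<Rightarrow> bool"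
  where "local_max_at U h z \<longleftrightarrow> z \<in> U \<and> (\<forall>\<^sub>F w in at z within U. h w \<le> h z)"

definition local_min_at :: "'a::topological_space set \<Rightarrow> ('a \<Rightarrow> real) \<Rightarrow> 'a \<Rightarrow> bool"
  where "local_min_at U h z \<longleftrightarrow> z \<in> U \<and> (\<forall>\<^sub>F w in at z within U. h z \<le> h w)"

definition cylinder :: "'a set \<Rightarrow> real \<Rightarrow> ('a \<times> real) set"
  where "cylinder \<Omega> T = \<Omega> \<times> {0..T}"

definition parabolic_boundary :: "'a set \<Rightarrow> 'a set \<Rightarrow> real \<Rightarrow> ('a \<times> real) set"
  where "parabolic_boundary \<Omega> \<Gamma> T = (\<Gamma> \<times> {0<..<T}) \<union> (\<Omega> \<times> {0})"

definition inner_cylinder :: "'a set \<Rightarrow> 'a set \<Rightarrow> real \<Rightarrow> ('a \<times> real) set"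
  where "inner_cylinder \<Omega> \<Gamma> T = (\<Omega> - \<Gamma>) \<times> {0<..<T}"

definition visc_subsol_inner ::
  "'a::real_inner set \<Rightarrow> 'a set \<Rightarrow> real \<Rightarrow> ('a \<Rightarrow> real) \<Rightarrow> ('a \<times> real \<Rightarrow> real) \<Rightarrow> bool"
  where "visc_subsol_inner \<Omega> \<Gamma> T P f \<longleftrightarrow>
    usc_on (cylinder \<Omega> T) f \<and>
    (\<forall>\<phi> x\<^sub>0 t\<^sub>0. C1_on (inner_cylinder \<Omega> \<Gamma> T) \<phi> \<longrightarrow>
       local_max_at (inner_cylinder \<Omega> \<Gamma> T) (\<lambda>z. f z - \<phi> z) (x\<^sub>0, t\<^sub>0) \<longrightarrow>
       deriv (\<lambda>t. \<phi> (x\<^sub>0, t)) t\<^sub>0 \<le> - norm (grad (\<lambda>x. \<phi> (x, t\<^sub>0)) x\<^sub>0) + P x\<^sub>0)"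

definition visc_supersol_inner ::
  "'a::real_inner set \<Rightarrow> 'a set \<Rightarrow> real \<Rightarrow> ('a \<Rightarrow> real) \<Rightarrow> ('a \<times> real \<Rightarrow> real) \<Rightarrow> bool"
  where "visc_supersol_inner \<Omega> \<Gamma> T P f \<longleftrightarrow>
    lsc_on (cylinder \<Omega> T) f \<and>
    (\<forall>\<phi> x\<^sub>0 t\<^sub>0. C1_on (inner_cylinder \<Omega> \<Gamma> T) \<phi> \<longrightarrow>
       local_min_at (inner_cylinder \<Omega> \<Gamma> T) (\<lambda>z. f z - \<phi> z) (x\<^sub>0, t\<^sub>0) \<longrightarrow>
       deriv (\<lambda>t. \<phi> (x\<^sub>0, t)) t\<^sub>0 \<ge> - norm (grad (\<lambda>x. \<phi> (x, t\<^sub>0)) x\<^sub>0) + P x\<^sub>0)"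

definition visc_subsol ::
  "'a::real_inner set \<Rightarrow> 'a set \<Rightarrow> real \<Rightarrow> ('a \<Rightarrow> real) \<Rightarrow> ('a \<Rightarrow> real) \<Rightarrow>
    ('a \<times> real \<Rightarrow> real) \<Rightarrow> bool"
  where "visc_subsol \<Omega> \<Gamma> T P \<psi> f \<longleftrightarrow>
    visc_subsol_inner \<Omega> \<Gamma> T P f \<and> (\<forall>(x, t)\<in>parabolic_boundary \<Omega> \<Gamma> T. f (x, t) \<le> \<psi> x)"

definition visc_supersol ::
  "'a::real_inner set \<Rightarrow> 'a set \<Rightarrow> real \<Rightarrow> ('a \<Rightarrow> real) \<Rightarrow> ('a \<Rightarrow> real) \<Rightarrow>
    ('a \<times> real \<Rightarrow> real) \<Rightarrow> bool"
  where "visc_supersol \<Omega> \<Gamma> T P \<psi> f \<longleftrightarrow>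
    visc_supersol_inner \<Omega> \<Gamma> T P f \<and> (\<forall>(x, t)\<in>parabolic_boundary \<Omega> \<Gamma> T. f (x, t) \<ge> \<psi> x)"

definition visc_solution ::
  "'a::real_inner set \<Rightarrow> 'a set \<Rightarrow> real \<Rightarrow> ('a \<Rightarrow> real) \<Rightarrow> ('a \<Rightarrow> real) \<Rightarrow>
    ('a \<times> real \<Rightarrow> real) \<Rightarrow> bool"
  where "visc_solution \<Omega> \<Gamma> T P \<psi> f \<longleftrightarrow>
    locally_bounded_on (cylinder \<Omega> T) f \<and>
    visc_subsol \<Omega> \<Gamma> T P \<psi> (usc_envelope (cylinder \<Omega> T) f) \<and>
    visc_supersol \<Omega> \<Gamma> T P \<psi> (lsc_envelope (cylinder \<Omega> T) f)"

end

theory Submission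
  imports Defs
begin

text \<open>
  Write \<open>M\<close> for the supremum of \<open>P\<close> and \<open>L\<close> for the Lipschitz constant of \<open>\<psi>\<close>. Formally
  \<open>f\<^sub>t = P - |\<nabla>f|\<close>, so both claims are first order estimates: \<open>- L \<le> f\<^sub>t \<le> M\<close> gives the Lipschitz
  bound in time, and then \<open>|\<nabla>f| = P - f\<^sub>t \<le> M + L\<close> gives the one in space.

  The bound \<open>f\<^sub>t \<ge> - L\<close> is global and comes from the comparison principle (lemma
  \<open>comparison_principle\<close>): \<open>\<psi> - L t\<close> is a sub-solution below the data, hence
  \<open>f (\<cdot>,h) \<ge> \<psi> - L h\<close>; since the equation and the lateral data do not depend on time,
  comparing \<open>f\<close> with its translate by \<open>h\<close> extends this to \<open>f (\<cdot>,t+h) \<ge> f (\<cdot>,t) - L h\<close>.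

  The other two bounds are local and follow from the sub-solution property alone. A smooth function
  touching \<open>f\<close> from above has time derivative at most \<open>M\<close>; by the lower bound in time this derivative is
  at least \<open>- L\<close>, so its space gradient has norm at most \<open>M + L\<close>. Lemma
  \<open>directional_growth_bound\<close> converts a bound on one directional component of all upper test slopes
  into a bound for the growth of \<open>f\<close> along a segment, which is applied to vertical and to horizontal
  segments in \<open>(\<Omega> - \<Gamma>) \<times> (0,T)\<close>. Horizontal segments meeting \<open>\<Gamma>\<close> are treated by
  \<open>lipschitz_on_glue_convex\<close>, where the values on \<open>\<Gamma>\<close> are those of \<open>\<psi>\<close>. The times \<open>0\<close> and \<open>T\<close> are
  reached by continuity, and \<open>M + L \<le> 2 M + L\<close> since \<open>M \<ge> 0\<close>.
\<close>

section \<open>Proximal sub- and super-solutions\<close>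

text \<open>These are the sub- and super-solutions of \<open>u\<^sub>t + |\<nabla>u| = P\<close> when the only test functions are
  quadratics, so that \<open>q\<close> collects the space gradient \<open>fst q\<close> and the time derivative \<open>snd q\<close> of
  the test function at the contact point. All penalisations below are quadratic, so this notion
  is enough for them. It does not mention a global class of test functions, which
  makes it stable under restriction to smaller sets and under translation in time.\<close>

definition prox_subsol ::
  "('a::real_inner \<times> real) set \<Rightarrow> ('a \<Rightarrow> real) \<Rightarrow> ('a \<times> real \<Rightarrow> real) \<Rightarrow> bool"
  where "prox_subsol U P u \<longleftrightarrow>
    (\<forall>z\<in>U. \<forall>q C. (\<forall>\<^sub>F w in nhds z. u w \<le> u z + q \<bullet> (w - z) + C * (norm (w - z))\<^sup>2) \<longrightarrow>
       snd q + norm (fst q) \<le> P (fst z))"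

definition prox_supersol ::
  "('a::real_inner \<times> real) set \<Rightarrow> ('a \<Rightarrow> real) \<Rightarrow> ('a \<times> real \<Rightarrow> real) \<Rightarrow> bool"
  where "prox_supersol U P u \<longleftrightarrow>
    (\<forall>z\<in>U. \<forall>q C. (\<forall>\<^sub>F w in nhds z. u w \<ge> u z + q \<bullet> (w - z) - C * (norm (w - z))\<^sup>2) \<longrightarrow>
       snd q + norm (fst q) \<ge> P (fst z))"

lemma GDERIV_imp_grad:
  assumes "GDERIV h x :> D"
  shows "grad h x = D"
proof -
  have "D' = D" if "GDERIV h x :> D'" for D'
  proof -
    have "(\<lambda>v. v \<bullet> D') = (\<lambda>v. v \<bullet> D)"
      using has_derivative_unique that assms unfolding gderiv_def by blast
    then show ?thesis
      by (metis vector_eq_ldot)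
  qed
  then show ?thesis
    unfolding grad_def using assms by blast
qed

lemma GDERIV_quadratic:
  "GDERIV (\<lambda>z. q \<bullet> (z - a) + C * (norm (z - a))\<^sup>2) x :> q + (2 * C) *\<^sub>R (x - a)"
  unfolding gderiv_def power2_norm_eq_inner
  by (rule derivative_eq_intros refl | simp add: fun_eq_iff inner_simps inner_commute algebra_simps)+

lemma quadratic_test_function:
  fixes q z :: "'a::real_inner \<times> real" and C :: real
  defines "\<phi> \<equiv> \<lambda>w. q \<bullet> (w - z) + C * (norm (w - z))\<^sup>2"
  shows "C1_on V \<phi>"
    and "deriv (\<lambda>t. \<phi> (fst z, t)) (snd z) = snd q"
    and "grad (\<lambda>x. \<phi> (x, snd z)) (fst z) = fst q"
proof -
  show "C1_on V \<phi>"
    unfolding C1_on_def \<phi>_def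
    by (rule exI[of _ "\<lambda>x. q + (2 * C) *\<^sub>R (x - z)"])
      (auto intro!: GDERIV_quadratic continuous_intros)
  have "(\<lambda>t. \<phi> (fst z, t)) = (\<lambda>t. snd q \<bullet> (t - snd z) + C * (norm (t - snd z))\<^sup>2)"
    by (simp add: \<phi>_def inner_prod_def norm_prod_def fun_eq_iff)
  moreover have "((\<lambda>t. snd q \<bullet> (t - snd z) + C * (norm (t - snd z))\<^sup>2) has_real_derivative snd q) (at (snd z))"
    using GDERIV_quadratic[of "snd q" "snd z" C "snd z"] by simp
  ultimately show "deriv (\<lambda>t. \<phi> (fst z, t)) (snd z) = snd q"
    by (simp add: DERIV_imp_deriv)
  have "(\<lambda>x. \<phi> (x, snd z)) = (\<lambda>x. fst q \<bullet> (x - fst z) + C * (norm (x - fst z))\<^sup>2)"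
    by (simp add: \<phi>_def inner_prod_def norm_prod_def fun_eq_iff)
  then show "grad (\<lambda>x. \<phi> (x, snd z)) (fst z) = fst q"
    using GDERIV_imp_grad[OF GDERIV_quadratic[of "fst q" "fst z" C "fst z"]] by simp
qed

text \<open>The neighbourhood filter of the envelopes includes the point \<open>z\<close> itself; splitting it into the
  punctured part and \<open>{z}\<close> reduces the claim to continuity.\<close>

lemma envelope_eq_of_continuous:
  assumes "continuous_on S h" "z \<in> S"
  shows "usc_envelope S h z = h z" "lsc_envelope S h z = h z"
proof -
  have eq: "inf (nhds z) (principal S) = sup (at z within S) (principal {z})"
    using assms(2) by (auto simp: filter_eq_iff eventually_inf_principal eventually_sup 
        eventually_principal eventually_at_filter elim: eventually_mono dest: eventually_nhds_x_imp_x)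
  have "(h \<longlongrightarrow> h z) (at z within S)"
    using assms by (simp add: continuous_on_def)
  then have "(h \<longlongrightarrow> h z) (inf (nhds z) (principal S))"
    unfolding eq by (auto simp: filterlim_sup tendsto_principal_singleton)
  then have lim: "((\<lambda>w. ereal (h w)) \<longlongrightarrow> ereal (h z)) (inf (nhds z) (principal S))"
    by simp
  have "inf (nhds z) (principal S) \<noteq> bot"
    unfolding eq by (simp add: sup_eq_bot_iff principal_eq_bot_iff)
  then show "usc_envelope S h z = h z" "lsc_envelope S h z = h z"
    using lim_imp_Limsup[OF _ lim] lim_imp_Liminf[OF _ lim]
    by (simp_all add: usc_envelope_def lsc_envelope_def)
qed

lemma visc_solution_imp_prox:
  fixes f :: "'a::real_inner \<times> real \<Rightarrow> real"
  assumes sol: "visc_solution \<Omega> \<Gamma> T P \<psi> f" and cont: "continuous_on (cylinder \<Omega> T) f"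
  shows "prox_subsol (inner_cylinder \<Omega> \<Gamma> T) P f"
    and "prox_supersol (inner_cylinder \<Omega> \<Gamma> T) P f"
proof -
  let ?U = "inner_cylinder \<Omega> \<Gamma> T"
  have sub: "?U \<subseteq> cylinder \<Omega> T"
    by (auto simp: inner_cylinder_def cylinder_def)
  note env = envelope_eq_of_continuous[OF cont subsetD[OF sub]]
  show "prox_subsol ?U P f"
    unfolding prox_subsol_def
  proof (intro ballI allI impI)
    fix z q C
    assume z: "z \<in> ?U" and ev: "\<forall>\<^sub>F w in nhds z. f w \<le> f z + q \<bullet> (w - z) + C * (norm (w - z))\<^sup>2"
    let ?\<phi> = "\<lambda>w. q \<bullet> (w - z) + C * (norm (w - z))\<^sup>2"
    have "\<forall>\<^sub>F w in at z within ?U. f w \<le> f z + q \<bullet> (w - z) + C * (norm (w - z))\<^sup>2"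
      using ev by (simp add: eventually_at_filter eventually_mono)
    moreover have "\<forall>\<^sub>F w in at z within ?U. w \<in> ?U"
      by (simp add: eventually_at_filter)
    ultimately have "\<forall>\<^sub>F w in at z within ?U.
        usc_envelope (cylinder \<Omega> T) f w - ?\<phi> w \<le> usc_envelope (cylinder \<Omega> T) f z - ?\<phi> z"
      by eventually_elim (use z in \<open>simp add: env\<close>)
    then have "local_max_at ?U (\<lambda>w. usc_envelope (cylinder \<Omega> T) f w - ?\<phi> w) (fst z, snd z)"
      using z by (simp add: local_max_at_def)
    then have "deriv (\<lambda>t. ?\<phi> (fst z, t)) (snd z) \<le> - norm (grad (\<lambda>x. ?\<phi> (x, snd z)) (fst z)) + P (fst z)"
      using sol quadratic_test_function(1)[of ?U q z C]
      unfolding visc_solution_def visc_subsol_def visc_subsol_inner_def by blast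
    then show "snd q + norm (fst q) \<le> P (fst z)"
      unfolding quadratic_test_function(2,3) by simp
  qed
  show "prox_supersol ?U P f"
    unfolding prox_supersol_def
  proof (intro ballI allI impI)
    fix z q C
    assume z: "z \<in> ?U" and ev: "\<forall>\<^sub>F w in nhds z. f w \<ge> f z + q \<bullet> (w - z) - C * (norm (w - z))\<^sup>2"
    let ?\<phi> = "\<lambda>w. q \<bullet> (w - z) + (- C) * (norm (w - z))\<^sup>2"
    have "\<forall>\<^sub>F w in at z within ?U. f w \<ge> f z + q \<bullet> (w - z) - C * (norm (w - z))\<^sup>2"
      using ev by (simp add: eventually_at_filter eventually_mono)
    moreover have "\<forall>\<^sub>F w in at z within ?U. w \<in> ?U"
      by (simp add: eventually_at_filter)
    ultimately have "\<forall>\<^sub>F w in at z within ?U.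
        lsc_envelope (cylinder \<Omega> T) f z - ?\<phi> z \<le> lsc_envelope (cylinder \<Omega> T) f w - ?\<phi> w"
      by eventually_elim (use z in \<open>simp add: env\<close>)
    then have "local_min_at ?U (\<lambda>w. lsc_envelope (cylinder \<Omega> T) f w - ?\<phi> w) (fst z, snd z)"
      using z by (simp add: local_min_at_def)
    then have "deriv (\<lambda>t. ?\<phi> (fst z, t)) (snd z) \<ge> - norm (grad (\<lambda>x. ?\<phi> (x, snd z)) (fst z)) + P (fst z)"
      using sol quadratic_test_function(1)[of ?U q z "- C"]
      unfolding visc_solution_def visc_supersol_def visc_supersol_inner_def by blast
    then show "snd q + norm (fst q) \<ge> P (fst z)"
      unfolding quadratic_test_function(2,3) by simp
  qed
qed

text \<open>The parabolic boundary omits \<open>\<Gamma> \<times> {T}\<close>; continuity supplies the boundary value there.\<close>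

lemma visc_solution_boundary:
  fixes f :: "'a::real_inner \<times> real \<Rightarrow> real"
  assumes sol: "visc_solution \<Omega> \<Gamma> T P \<psi> f" and cont: "continuous_on (cylinder \<Omega> T) f"
    and "0 < T" "\<Gamma> \<subseteq> \<Omega>"
  shows "x \<in> \<Omega> \<Longrightarrow> f (x, 0) = \<psi> x"
    and "x \<in> \<Gamma> \<Longrightarrow> t \<in> {0..T} \<Longrightarrow> f (x, t) = \<psi> x"
proof -
  have bd: "f z = \<psi> (fst z)" if "z \<in> parabolic_boundary \<Omega> \<Gamma> T" for z
  proof -
    have "z \<in> cylinder \<Omega> T"
      using that assms(3,4) by (auto simp: parabolic_boundary_def cylinder_def)
    then show ?thesis
      using sol that envelope_eq_of_continuous[OF cont]
      unfolding visc_solution_def visc_subsol_def visc_supersol_def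
      by (metis (mono_tags, lifting) case_prod_beta' order_antisym prod.collapse)
  qed
  show "f (x, 0) = \<psi> x" if "x \<in> \<Omega>" for x
    using bd[of "(x, 0)"] that by (simp add: parabolic_boundary_def)
  show "f (x, t) = \<psi> x" if "x \<in> \<Gamma>" "t \<in> {0..T}" for x t
  proof -
    have "continuous_on {0..T} (\<lambda>t. f (x, t))"
      by (rule continuous_on_compose2[OF cont])
        (use that assms(4) in \<open>auto simp: cylinder_def intro!: continuous_intros\<close>)
    then have "f (x, t) = \<psi> x" 
      using continuous_constant_on_closure[of "{0<..<T}" "\<lambda>t. f (x, t)" "\<psi> x" t] that assms(3) bd
      by (auto simp: parabolic_boundary_def closure_greaterThanLessThan)
    then show ?thesis .
  qed
qed


section \<open>Monotonicity along a segment\<close>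

lemma norm_diff_sq_expand:
  fixes a b y :: "'a::real_inner"
  shows "(norm (a - y))\<^sup>2 = (norm (b - y))\<^sup>2 + 2 * ((b - y) \<bullet> (a - b)) + (norm (a - b))\<^sup>2"
  by (simp add: power2_norm_eq_inner inner_simps inner_commute)

text \<open>First order information is read off from increments of size \<open>s\<close> by dividing by \<open>s\<close> and
  letting \<open>s\<close> tend to 0. One-sided increments suffice, also at an endpoint of an interval.\<close>

lemma le_of_le_add_small:
  fixes a b C :: real
  assumes "\<forall>\<^sub>F s in at_right 0. s * a \<le> s * b + C * s\<^sup>2"
  shows "a \<le> b"
proof (rule tendsto_le[of "at_right (0::real)"])
  show "((\<lambda>s. b + C * s) \<longlongrightarrow> b) (at_right 0)"
    by (rule tendsto_eq_intros refl | simp)+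
  have "\<forall>\<^sub>F s in at_right (0::real). s > 0"
    by (simp add: eventually_at_right_less)
  with assms show "\<forall>\<^sub>F s in at_right 0. a \<le> b + C * s"
  proof eventually_elim
    case (elim s)
    then have "s * a \<le> s * (b + C * s)"
      by (simp add: algebra_simps power2_eq_square)
    with elim show ?case by simp
  qed
qed simp_all

text \<open>A quadratic touching \<open>u\<close> from above at \<open>z\<close> inherits every lower bound on the growth of \<open>u\<close>
  in a direction. This turns one-sided Lipschitz bounds for \<open>u\<close> into bounds on the slopes of its
  test functions.\<close>

lemma quadratic_test_slope:
  fixes z q d :: "'a::real_inner"
  assumes "\<forall>\<^sub>F w in nhds z. u w \<le> u z + q \<bullet> (w - z) + C * (norm (w - z))\<^sup>2"
    and "\<forall>\<^sub>F s in at_right 0. u z + s * c \<le> u (z + s *\<^sub>R d)"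
  shows "c \<le> q \<bullet> d"
proof (rule le_of_le_add_small)
  have "((\<lambda>s. z + s *\<^sub>R d) \<longlongrightarrow> z) (at_right 0)"
    by (rule tendsto_eq_intros refl | simp)+
  then have "\<forall>\<^sub>F s in at_right 0. u (z + s *\<^sub>R d) \<le> u z + q \<bullet> (s *\<^sub>R d) + C * (norm (s *\<^sub>R d))\<^sup>2"
    using assms(1) by (auto simp: filterlim_iff)
  with assms(2) show "\<forall>\<^sub>F s in at_right 0. s * c \<le> s * (q \<bullet> d) + (C * (norm d)\<^sup>2) * s\<^sup>2"
    by eventually_elim (simp add: power_mult_distrib algebra_simps)
qed

text \<open>If every upper test slope has component at most \<open>M\<close> along \<open>d = z\<^sub>1 - z\<^sub>0\<close>, then \<open>u\<close> grows by at
  most \<open>M\<close> from \<open>z\<^sub>0\<close> to \<open>z\<^sub>1\<close>. The function \<open>u\<close> is compared with a linear function of the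
  parameter \<open>\<tau>\<close> of the segment by maximising
  \<open>u (z\<^sub>0 + \<tau>d + h) - A |h|\<^sup>2 - \<tau> (M + \<eta>)\<close> over a tube around the segment. For large \<open>A\<close> a maximiser
  has \<open>h\<close> small, hence an interior contact point with test slope \<open>2Ah\<close>. Moving the
  foot point backwards along the segment while keeping the contact point fixed gives
  \<open>M + \<eta> \<le> 2Ah \<bullet> d\<close>, a contradiction. Only backward moves are used, so a maximum at the end
  \<open>\<tau> = 1\<close> causes no difficulty.\<close>

lemma directional_growth_bound:
  fixes u :: "'a::euclidean_space \<Rightarrow> real"
  assumes U: "open U" "continuous_on U u" "closed_segment z\<^sub>0 z\<^sub>1 \<subseteq> U"
    and slope: "\<And>z q C. z \<in> U \<Longrightarrow> \<forall>\<^sub>F w in nhds z. u w \<le> u z + q \<bullet> (w - z) + C * (norm (w - z))\<^sup>2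
                  \<Longrightarrow> q \<bullet> (z\<^sub>1 - z\<^sub>0) \<le> M"
  shows "u z\<^sub>1 \<le> u z\<^sub>0 + M"
proof (rule ccontr)
  assume contra: "\<not> ?thesis"
  define \<eta> where "\<eta> = (u z\<^sub>1 - u z\<^sub>0 - M) / 2"
  define d where "d = z\<^sub>1 - z\<^sub>0"
  have \<eta>: "\<eta> > 0" and u1: "u z\<^sub>1 = u z\<^sub>0 + M + 2 * \<eta>"
    using contra by (auto simp: \<eta>_def field_simps)
  obtain r where r: "r > 0" "(\<Union>z\<in>closed_segment z\<^sub>0 z\<^sub>1. cball z r) \<subseteq> U"
    using compact_subset_open_imp_cball_epsilon_subset[OF compact_segment U(1,3)] by blast
  have tube: "z\<^sub>0 + \<tau> *\<^sub>R d + h \<in> U" if "\<tau> \<in> {0..1}" "norm h \<le> r" for \<tau> h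
  proof -
    have "z\<^sub>0 + \<tau> *\<^sub>R d \<in> closed_segment z\<^sub>0 z\<^sub>1"
      using that(1) by (auto simp: in_segment d_def algebra_simps)
    then show ?thesis
      using r(2) that(2) by (force simp: dist_norm)
  qed
  have "isCont u z\<^sub>0"
    using U by (metis continuous_on_eq_continuous_at ends_in_segment(1) subsetD)
  then obtain r' where r': "r' > 0" "\<And>h. norm h < r' \<Longrightarrow> u (z\<^sub>0 + h) < u z\<^sub>0 + \<eta>"
    using \<eta> unfolding continuous_at_eps_delta
    by (metis abs_less_iff add_diff_cancel_left' dist_norm dist_real_def diff_less_eq add.commute)
  define \<rho> where "\<rho> = min r r' / 2"
  have \<rho>: "\<rho> > 0" "\<rho> < r" "\<rho> < r'"
    using r(1) r'(1) by (auto simp: \<rho>_def)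
  let ?K = "cball (0::'a) r \<times> {0..1::real}"
  have cont: "continuous_on ?K (\<lambda>(h, \<tau>). u (z\<^sub>0 + \<tau> *\<^sub>R d + h))"
    unfolding case_prod_beta
    by (rule continuous_on_compose2[OF U(2)]) (auto intro!: continuous_intros tube)
  have cpt: "compact ?K"
    by (intro compact_Times compact_cball) auto
  obtain B where B: "\<And>h \<tau>. norm h \<le> r \<Longrightarrow> \<tau> \<in> {0..1} \<Longrightarrow> \<bar>u (z\<^sub>0 + \<tau> *\<^sub>R d + h)\<bar> \<le> B"
    using compact_imp_bounded[OF compact_continuous_image[OF cont cpt]]
    unfolding bounded_iff by force
  \<comment> \<open>Large enough that a competitor with \<open>|h| \<ge> \<rho>\<close> loses against the value at \<open>h = 0\<close>, \<open>\<tau> = 1\<close>.\<close>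
  define A where "A = (B + \<bar>M + \<eta>\<bar> + \<bar>u z\<^sub>0 + \<eta>\<bar> + 1) / \<rho>\<^sup>2"
  have B0: "B \<ge> 0"
    using B[of 0 0] r(1) by simp
  have A: "A * \<rho>\<^sup>2 = B + \<bar>M + \<eta>\<bar> + \<bar>u z\<^sub>0 + \<eta>\<bar> + 1" "A > 0"
    using \<rho>(1) B0 by (auto simp: A_def intro!: divide_pos_pos)
  define \<Phi> where "\<Phi> = (\<lambda>(h, \<tau>). u (z\<^sub>0 + \<tau> *\<^sub>R d + h) - A * (norm h)\<^sup>2 - \<tau> * (M + \<eta>))"
  have "continuous_on ?K \<Phi>"
    unfolding \<Phi>_def case_prod_beta
    using cont by (auto simp: case_prod_beta intro!: continuous_intros)
  moreover have "?K \<noteq> {}"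
    using r(1) by auto
  ultimately obtain p where "p \<in> ?K" "\<forall>p'\<in>?K. \<Phi> p' \<le> \<Phi> p"
    using continuous_attains_sup[OF cpt] by blast
  then obtain h \<tau> where h: "norm h \<le> r" and \<tau>: "\<tau> \<in> {0..1}"
    and max: "\<And>h' \<tau>'. norm h' \<le> r \<Longrightarrow> \<tau>' \<in> {0..1} \<Longrightarrow> \<Phi> (h', \<tau>') \<le> \<Phi> (h, \<tau>)"
    by (cases p) auto
  let ?z = "z\<^sub>0 + \<tau> *\<^sub>R d + h"
  have low: "u z\<^sub>0 + \<eta> \<le> u ?z - A * (norm h)\<^sup>2 - \<tau> * (M + \<eta>)"
    using max[of 0 1] r(1) u1 by (simp add: \<Phi>_def d_def)
  have "norm h < \<rho>"
  proof (rule ccontr)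
    assume "\<not> norm h < \<rho>"
    then have "A * \<rho>\<^sup>2 \<le> A * (norm h)\<^sup>2"
      using A(2) \<rho>(1) by (intro mult_left_mono power_mono) auto
    moreover have "- (\<tau> * (M + \<eta>)) \<le> \<bar>M + \<eta>\<bar>"
      using \<tau> by (metis abs_ge_minus_self abs_mult abs_of_nonneg atLeastAtMost_iff dual_order.trans mult_left_le_one_le abs_ge_zero)
    ultimately show False
      using low A(1) B[OF h \<tau>] by linarith
  qed
  then have hr: "norm h < r" "norm h < r'"
    using \<rho> by auto
  have "\<tau> \<noteq> 0"
  proof
    assume "\<tau> = 0"
    then have "u z\<^sub>0 + \<eta> \<le> u (z\<^sub>0 + h) - A * (norm h)\<^sup>2"
      using low by simp
    then show False
      using r'(2)[OF hr(2)] mult_nonneg_nonneg[OF less_imp_le[OF A(2)] zero_le_power2[of "norm h"]] by linarith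
  qed
  with \<tau> have \<tau>0: "\<tau> > 0" by simp
  \<comment> \<open>The pairs \<open>(h + sd, \<tau> - s)\<close> all describe the same contact point.\<close>
  have "M + \<eta> \<le> (2 * A) *\<^sub>R h \<bullet> d"
  proof (rule le_of_le_add_small)
    have "((\<lambda>s. norm (h + s *\<^sub>R d)) \<longlongrightarrow> norm h) (at_right 0)"
      by (rule tendsto_eq_intros refl | simp)+
    then have "\<forall>\<^sub>F s in at_right 0. norm (h + s *\<^sub>R d) < r"
      using hr(1) by (rule order_tendstoD)
    moreover have "\<forall>\<^sub>F s in at_right (0::real). s \<in> {0<..<\<tau>}"
      using \<tau>0 by (rule eventually_at_right_real)
    ultimately show "\<forall>\<^sub>F s in at_right 0. s * (M + \<eta>) \<le> s * ((2 * A) *\<^sub>R h \<bullet> d) + (A * (norm d)\<^sup>2) * s\<^sup>2"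
    proof eventually_elim
      case (elim s)
      have "z\<^sub>0 + (\<tau> - s) *\<^sub>R d + (h + s *\<^sub>R d) = ?z"
        by (simp add: algebra_simps)
      moreover have "\<Phi> (h + s *\<^sub>R d, \<tau> - s) \<le> \<Phi> (h, \<tau>)"
        using elim \<tau> by (intro max) auto
      moreover have "(norm (h + s *\<^sub>R d))\<^sup>2 = (norm h)\<^sup>2 + 2 * (s * (h \<bullet> d)) + s\<^sup>2 * (norm d)\<^sup>2"
        using norm_diff_sq_expand[of "h + s *\<^sub>R d" 0 h] by (simp add: power_mult_distrib)
      ultimately show ?case
        by (simp add: \<Phi>_def algebra_simps)
    qed
  qed
  moreover have "(2 * A) *\<^sub>R h \<bullet> (z\<^sub>1 - z\<^sub>0) \<le> M"
  proof (rule slope)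
    show "?z \<in> U"
      using tube \<tau> h by blast
    have "\<forall>\<^sub>F w in nhds ?z. dist w ?z < r - norm h"
      using hr(1) by (metis diff_gt_0_iff_gt eventually_nhds_metric)
    then show "\<forall>\<^sub>F w in nhds ?z. u w \<le> u ?z + (2 * A) *\<^sub>R h \<bullet> (w - ?z) + A * (norm (w - ?z))\<^sup>2"
    proof eventually_elim
      case (elim w)
      define h' where "h' = w - (z\<^sub>0 + \<tau> *\<^sub>R d)"
      have w: "w = z\<^sub>0 + \<tau> *\<^sub>R d + h'" "w - ?z = h' - h"
        by (simp_all add: h'_def)
      have "norm h' \<le> r"
        using elim norm_triangle_sub[of h' h] by (simp add: dist_norm w)
      then have "\<Phi> (h', \<tau>) \<le> \<Phi> (h, \<tau>)"
        using max \<tau> by blast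
      then have "u w - A * (norm h')\<^sup>2 \<le> u ?z - A * (norm h)\<^sup>2"
        by (simp add: \<Phi>_def w(1))
      moreover have "A * (norm h')\<^sup>2 = A * (norm h)\<^sup>2 + (2 * A) *\<^sub>R h \<bullet> (h' - h) + A * (norm (h' - h))\<^sup>2"
        using norm_diff_sq_expand[of h' 0 h] by (simp add: distrib_left)
      ultimately show ?case
        unfolding w(2) by linarith
    qed
  qed
  ultimately show False
    using \<eta> by (simp add: d_def)
qed

section \<open>Gluing Lipschitz bounds across the boundary\<close>

text \<open>The set \<open>\<Omega>\<close> need not be convex, so a segment joining two of its points may leave it. Since
  \<open>\<Omega> - \<Gamma>\<close> is open, the topological boundary of \<open>\<Omega>\<close> lies in \<open>\<Gamma>\<close>, and a segment leaving
  \<open>\<Omega> - \<Gamma>\<close> must meet \<open>\<Gamma>\<close>. A segment from \<open>x \<in> \<Omega>\<close> to \<open>z \<in> \<Gamma>\<close> is cut at its first point in \<open>\<Gamma>\<close>: the piece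
  before it lies in \<open>\<Omega> - \<Gamma>\<close> up to an end point, and the rest is bridged by the bound on \<open>\<Gamma>\<close>. A
  segment between two points of \<open>\<Omega>\<close> that meets \<open>\<Gamma>\<close> consists of two such segments. Distances along
  a segment add up, so the constant is not enlarged.\<close>

lemma lipschitz_on_glue_convex:
  fixes g :: "'a::euclidean_space \<Rightarrow> 'b::metric_space"
  assumes "closed \<Gamma>" "\<Gamma> \<subseteq> \<Omega>" "closed \<Omega>" "open (\<Omega> - \<Gamma>)" "continuous_on \<Omega> g"
    and \<Gamma>: "K-lipschitz_on \<Gamma> g"
    and convex: "\<And>C. convex C \<Longrightarrow> C \<subseteq> \<Omega> - \<Gamma> \<Longrightarrow> K-lipschitz_on C g"
  shows "K-lipschitz_on \<Omega> g"
proof (rule lipschitz_onI)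
  show "0 \<le> K"
    using \<Gamma> by (rule lipschitz_on_nonneg)
  have in_\<Omega>: "C \<subseteq> \<Omega> - \<Gamma>" if "convex C" "C \<inter> \<Gamma> = {}" "x \<in> C" "x \<in> \<Omega>" for C x
  proof -
    have "C \<inter> frontier \<Omega> = {}"
      using assms(2-4) that(2) interior_maximal[of "\<Omega> - \<Gamma>" \<Omega>] by (auto simp: frontier_def)
    then have "C \<subseteq> \<Omega>"
      using connected_Int_frontier[of C \<Omega>] convex_connected[OF that(1)] that by blast
    then show ?thesis
      using that(2) by blast
  qed
  have hit: "dist (g x) (g z) \<le> K * dist x z" if "x \<in> \<Omega>" "z \<in> \<Gamma>" for x z
  proof -
    have "closed (closed_segment x z \<inter> \<Gamma>)" "closed_segment x z \<inter> \<Gamma> \<noteq> {}"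
      using assms(1) that(2) by auto
    \<comment> \<open>The first point of \<open>\<Gamma>\<close> met on the way from \<open>x\<close> to \<open>z\<close>.\<close>
    then obtain y where y: "y \<in> closed_segment x z \<inter> \<Gamma>"
      and min: "\<And>w. w \<in> closed_segment x z \<inter> \<Gamma> \<Longrightarrow> dist x y \<le> dist x w"
      by (metis distance_attains_inf)
    have "dist (g x) (g y) \<le> K * dist x y"
    proof (cases "x = y")
      case False
      define C where "C = closed_segment x y \<inter> ball x (dist x y)"
      have "w \<notin> \<Gamma>" if "w \<in> C" for w
      proof
        assume "w \<in> \<Gamma>"
        have "w \<in> closed_segment x z"
          using that y by (metis C_def IntD1 ends_in_segment(1) subset_closed_segment subsetD)
        then show False
          using min[of w] \<open>w \<in> \<Gamma>\<close> that by (simp add: C_def)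
      qed
      moreover have "convex C"
        by (simp add: C_def convex_Int)
      moreover have "x \<in> C"
        using False by (simp add: C_def)
      ultimately have "C \<subseteq> \<Omega> - \<Gamma>"
        using in_\<Omega>[of C x] \<open>x \<in> \<Omega>\<close> by blast
      moreover have "open_segment x y \<subseteq> C"
        using dist_in_open_segment[of _ x y] by (force simp: C_def open_segment_def dist_commute)
      ultimately have sub: "open_segment x y \<subseteq> \<Omega> - \<Gamma>"
        by blast
      then have "closed_segment x y \<subseteq> \<Omega>"
        using assms(3) False by (metis Diff_subset closure_minimal closure_open_segment order_trans)
      then have "K-lipschitz_on (closed_segment x y) g"
        using lipschitz_on_closure[OF convex[OF convex_open_segment sub]] False
          continuous_on_subset[OF assms(5)] by simp
      then show ?thesis
        by (rule lipschitz_onD) auto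
    qed simp
    moreover have "dist (g y) (g z) \<le> K * dist y z"
      using lipschitz_onD[OF \<Gamma>] y that by blast
    moreover have "dist x z = dist x y + dist y z"
      using y by (simp add: between between_mem_segment flip: between)
    ultimately show ?thesis
      using dist_triangle[of "g x" "g z" "g y"] by (simp add: distrib_left)
  qed
  fix x y
  assume xy: "x \<in> \<Omega>" "y \<in> \<Omega>"
  show "dist (g x) (g y) \<le> K * dist x y"
  proof (cases "closed_segment x y \<inter> \<Gamma> = {}")
    case True
    then have "K-lipschitz_on (closed_segment x y) g"
      using in_\<Omega>[of "closed_segment x y" x] xy by (intro convex) auto
    then show ?thesis
      by (rule lipschitz_onD) auto
  next
    case False
    then obtain z where z: "z \<in> closed_segment x y" "z \<in> \<Gamma>"
      by blast
    then have "dist x y = dist x z + dist z y"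
      by (simp add: between_mem_segment flip: between)
    then show ?thesis
      using hit[OF xy(1) z(2)] hit[OF xy(2) z(2)] dist_triangle[of "g x" "g y" "g z"]
      by (simp add: distrib_left dist_commute)
  qed
qed

section \<open>Comparison principle\<close>

text \<open>Doubling of variables. Each of the two contact points \<open>z\<close>, \<open>w\<close> carries its own time, and both
  times are tied to a third one, \<open>\<tau>\<close>, which alone pays the price \<open>\<eta>\<close> per unit of time. As \<open>\<tau>\<close> is
  confined to \<open>[0,t]\<close> with \<open>t < T\<close>, the points \<open>z\<close> and \<open>w\<close> stay away from the final
  time, where nothing could be tested; a maximum at \<open>\<tau> = t\<close> is harmless
  because only backward variations of \<open>\<tau>\<close> are used. The two test slopes have the same space part,
  and their time parts differ by at least \<open>\<eta>\<close>, so \<open>\<eta> \<le> P (fst z) - P (fst w)\<close>. This contradicts the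
  uniform continuity of \<open>P\<close>: as \<open>|\<nabla>u|\<close> and \<open>P\<close> enter separately, the gradients cancel, and it is
  enough that \<open>z\<close> and \<open>w\<close> be close.\<close>

lemma comparison_principle:
  fixes u v :: "'a::euclidean_space \<times> real \<Rightarrow> real"
  assumes "compact \<Omega>" "open (\<Omega> - \<Gamma>)"
    and contu: "continuous_on (cylinder \<Omega> T) u" and contv: "continuous_on (cylinder \<Omega> T) v"
    and P: "uniformly_continuous_on (\<Omega> - \<Gamma>) P"
    and sub: "prox_subsol (inner_cylinder \<Omega> \<Gamma> T) P u"
    and super: "prox_supersol (inner_cylinder \<Omega> \<Gamma> T) P v"
    and init: "\<And>x. x \<in> \<Omega> \<Longrightarrow> u (x, 0) \<le> v (x, 0) + c"
    and side: "\<And>x t. x \<in> \<Gamma> \<Longrightarrow> t \<in> {0..T} \<Longrightarrow> u (x, t) \<le> v (x, t) + c"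
    and "x \<in> \<Omega>" "t \<in> {0..<T}"
  shows "u (x, t) \<le> v (x, t) + c"
proof (rule ccontr)
  assume contra: "\<not> ?thesis"
  have T: "0 < T"
    using assms(11) by auto
  define \<delta> where "\<delta> = u (x, t) - v (x, t) - c"
  have \<delta>: "\<delta> > 0"
    using contra by (simp add: \<delta>_def)
  define \<eta> where "\<eta> = \<delta> / (2 * T)"
  have \<eta>: "\<eta> > 0" "t * \<eta> \<le> \<delta> / 2"
    using \<delta> T assms(11) by (auto simp: \<eta>_def field_simps)
  have cyl: "compact (cylinder \<Omega> T)"
    unfolding cylinder_def using assms(1) by (intro compact_Times) auto
  obtain ru where ru: "ru > 0" "\<And>z w. z \<in> cylinder \<Omega> T \<Longrightarrow> w \<in> cylinder \<Omega> T \<Longrightarrow> dist z w < ru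
      \<Longrightarrow> \<bar>u z - u w\<bar> < \<delta> / 4"
    using compact_uniformly_continuous[OF contu cyl] \<delta> unfolding uniformly_continuous_on_def
    by (metis dist_real_def zero_less_divide_iff zero_less_numeral)
  obtain rv where rv: "rv > 0" "\<And>z w. z \<in> cylinder \<Omega> T \<Longrightarrow> w \<in> cylinder \<Omega> T \<Longrightarrow> dist z w < rv
      \<Longrightarrow> \<bar>v z - v w\<bar> < \<delta> / 4"
    using compact_uniformly_continuous[OF contv cyl] \<delta> unfolding uniformly_continuous_on_def
    by (metis dist_real_def zero_less_divide_iff zero_less_numeral)
  obtain rP where rP: "rP > 0" "\<And>x y. x \<in> \<Omega> - \<Gamma> \<Longrightarrow> y \<in> \<Omega> - \<Gamma> \<Longrightarrow> dist x y < rP \<Longrightarrow> \<bar>P x - P y\<bar> < \<eta>"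
    using P \<eta>(1) unfolding uniformly_continuous_on_def by (metis dist_real_def)
  define r where "r = min (min ru rv) (min rP (T - t)) / 4"
  have r: "r > 0" "4 * r \<le> ru" "4 * r \<le> rv" "4 * r \<le> rP" "4 * r \<le> T - t"
    using ru rv rP assms(11) by (auto simp: r_def)
  obtain Bu where Bu: "\<And>z. z \<in> cylinder \<Omega> T \<Longrightarrow> \<bar>u z\<bar> \<le> Bu"
    using compact_imp_bounded[OF compact_continuous_image[OF contu cyl]]
    unfolding bounded_iff by force
  obtain Bv where Bv: "\<And>z. z \<in> cylinder \<Omega> T \<Longrightarrow> \<bar>v z\<bar> \<le> Bv"
    using compact_imp_bounded[OF compact_continuous_image[OF contv cyl]]
    unfolding bounded_iff by force
  have B0: "0 \<le> Bu" "0 \<le> Bv"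
    using Bu[of "(x, t)"] Bv[of "(x, t)"] assms(10,11) by (auto simp: cylinder_def)
  \<comment> \<open>Large enough that each penalised distance is below \<open>r\<close> at a maximiser.\<close>
  define A where "A = (Bu + Bv + \<bar>c\<bar> + 1) / r\<^sup>2"
  have A: "A * r\<^sup>2 = Bu + Bv + \<bar>c\<bar> + 1" "A > 0"
    using r(1) B0 by (auto simp: A_def intro!: divide_pos_pos)
  define \<Phi> where "\<Phi> = (\<lambda>(z, w, \<tau>). u z - v w - A * (norm (fst z - fst w))\<^sup>2
    - A * (snd z - \<tau>)\<^sup>2 - A * (snd w - \<tau>)\<^sup>2 - \<tau> * \<eta>)"
  let ?K = "cylinder \<Omega> T \<times> cylinder \<Omega> T \<times> {0..t}"
  have "compact ?K"
    using cyl by (intro compact_Times) auto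
  moreover have "continuous_on ?K \<Phi>"
    unfolding \<Phi>_def case_prod_beta
    by (intro continuous_intros continuous_on_compose2[OF contu] continuous_on_compose2[OF contv]) auto
  moreover have base: "((x, t), (x, t), t) \<in> ?K"
    using assms(10,11) by (auto simp: cylinder_def)
  ultimately obtain p where "p \<in> ?K" "\<forall>p'\<in>?K. \<Phi> p' \<le> \<Phi> p"
    using continuous_attains_sup[of ?K \<Phi>] by blast
  then obtain z w \<tau> where z: "z \<in> cylinder \<Omega> T" and w: "w \<in> cylinder \<Omega> T" and \<tau>: "\<tau> \<in> {0..t}"
    and max: "\<And>z' w' \<tau>'. z' \<in> cylinder \<Omega> T \<Longrightarrow> w' \<in> cylinder \<Omega> T \<Longrightarrow> \<tau>' \<in> {0..t}
                \<Longrightarrow> \<Phi> (z', w', \<tau>') \<le> \<Phi> (z, w, \<tau>)"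
    by (cases p) auto
  have low: "c + \<delta> / 2 + A * (norm (fst z - fst w))\<^sup>2 + A * (snd z - \<tau>)\<^sup>2 + A * (snd w - \<tau>)\<^sup>2 \<le> u z - v w"
  proof -
    have "\<Phi> ((x, t), (x, t), t) \<le> \<Phi> (z, w, \<tau>)"
      using base by (intro max) auto
    moreover have "\<Phi> ((x, t), (x, t), t) = c + \<delta> - t * \<eta>"
      by (simp add: \<Phi>_def \<delta>_def)
    moreover have "0 \<le> \<tau> * \<eta>"
      using \<tau> \<eta> by auto
    ultimately show ?thesis
      using \<eta>(2) unfolding \<Phi>_def prod.case by linarith
  qed
  have pos: "0 \<le> A * a\<^sup>2" for a
    using A(2) by simp
  have small: "\<bar>a\<bar> < r" if "A * a\<^sup>2 \<le> u z - v w - c" for a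
  proof (rule ccontr)
    assume "\<not> \<bar>a\<bar> < r"
    then have "r\<^sup>2 \<le> a\<^sup>2"
      using r(1) by (simp add: abs_le_square_iff[symmetric])
    then have "A * r\<^sup>2 \<le> A * a\<^sup>2"
      using A(2) by simp
    then show False
      using that A(1) Bu[OF z] Bv[OF w] by linarith
  qed
  have "A * (norm (fst z - fst w))\<^sup>2 \<le> u z - v w - c" "A * (snd z - \<tau>)\<^sup>2 \<le> u z - v w - c"
      "A * (snd w - \<tau>)\<^sup>2 \<le> u z - v w - c"
    using low \<delta> pos[of "norm (fst z - fst w)"] pos[of "snd z - \<tau>"] pos[of "snd w - \<tau>"] by linarith+
  from this[THEN small] have close: "dist (fst z) (fst w) < r" "dist (snd z) \<tau> < r" "dist (snd w) \<tau> < r"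
    by (simp_all add: dist_norm)
  \<comment> \<open>\<open>u z - v w\<close> exceeds \<open>c\<close> by \<open>\<delta>/2\<close> and the moduli of continuity cost less than \<open>\<delta>/4\<close> each, so no
      point near \<open>z\<close> and \<open>w\<close> can lie where \<open>u \<le> v + c\<close> is assumed.\<close>
  have gap: "c < u y - v y" if "y \<in> cylinder \<Omega> T" "dist z y < 4 * r" "dist w y < 4 * r" for y
    using ru(2)[OF z that(1)] rv(2)[OF w that(1)] that low r(2,3) \<delta>
      pos[of "norm (fst z - fst w)"] pos[of "snd z - \<tau>"] pos[of "snd w - \<tau>"] by linarith
  have dist_le: "dist a b \<le> dist (fst a) (fst b) + dist (snd a) (snd b)" for a b :: "'a \<times> real"
    by (simp add: dist_prod_def sqrt_sum_squares_le_sum)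
  have zw: "dist z w < 4 * r"
    using dist_le[of z w] close r(1) dist_triangle2[of "snd z" "snd w" \<tau>] by linarith
  let ?y = "(fst z, \<tau>)"
  have "?y \<in> cylinder \<Omega> T"
    using z \<tau> assms(11) by (auto simp: cylinder_def)
  moreover have "dist z ?y < 4 * r" "dist w ?y < 4 * r"
    using dist_le[of z ?y] dist_le[of w ?y] close r(1) by (simp_all add: dist_commute)
  ultimately have gaps: "c < u z - v z" "c < u w - v w" "c < u ?y - v ?y"
    using gap[OF z] gap[OF w] gap zw r(1) by (simp_all add: dist_commute)
  have inner: "y \<in> inner_cylinder \<Omega> \<Gamma> T"
    if y: "y \<in> cylinder \<Omega> T" "c < u y - v y" "dist (snd y) \<tau> < r" for y
  proof -
    have "fst y \<notin> \<Gamma>"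
      using side[of "fst y" "snd y"] y by (auto simp: cylinder_def)
    moreover have "snd y \<noteq> 0"
      using init[of "fst y"] y by (cases y) (auto simp: cylinder_def)
    moreover have "snd y < T"
      using y(3) \<tau> r by (auto simp: dist_real_def)
    ultimately show ?thesis
      using y(1) by (auto simp: cylinder_def inner_cylinder_def)
  qed
  have zU: "z \<in> inner_cylinder \<Omega> \<Gamma> T" and wU: "w \<in> inner_cylinder \<Omega> \<Gamma> T"
    using inner[OF z] inner[OF w] gaps close by auto
  have "\<tau> \<noteq> 0"
    using gaps(3) init[of "fst z"] z by (auto simp: cylinder_def)
  with \<tau> have \<tau>0: "\<tau> > 0" by simp
  have "open (inner_cylinder \<Omega> \<Gamma> T)" (is "open ?U")
    unfolding inner_cylinder_def using assms(2) by (intro open_Times) auto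
  then have near: "\<forall>\<^sub>F y' in nhds y. y' \<in> cylinder \<Omega> T" if "y \<in> inner_cylinder \<Omega> \<Gamma> T" for y
    by (rule eventually_mono[OF eventually_nhds_in_open[of ?U]])
      (use that in \<open>auto simp: inner_cylinder_def cylinder_def\<close>)
  define e where "e = fst z - fst w"
  have norm_sq: "(norm p)\<^sup>2 = (norm (fst p))\<^sup>2 + (snd p)\<^sup>2" for p :: "'a \<times> real"
    by (simp add: norm_prod_def)
  let ?q = "(2 * A) *\<^sub>R (e, snd z - \<tau>)" and ?q' = "(2 * A) *\<^sub>R (e, \<tau> - snd w)"
  have "snd ?q + norm (fst ?q) \<le> P (fst z)"
  proof -
    have "\<forall>\<^sub>F y in nhds z. u y \<le> u z + ?q \<bullet> (y - z) + A * (norm (y - z))\<^sup>2"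
      using near[OF zU]
    proof eventually_elim
      case (elim y)
      have "\<Phi> (y, w, \<tau>) \<le> \<Phi> (z, w, \<tau>)"
        using elim w \<tau> by (rule max)
      moreover have "A * (norm (fst y - fst w))\<^sup>2 = A * (norm (fst z - fst w))\<^sup>2
          + A * (2 * (e \<bullet> (fst y - fst z))) + A * (norm (fst y - fst z))\<^sup>2"
        unfolding norm_diff_sq_expand[of "fst y" "fst w" "fst z"] e_def by (simp add: distrib_left)
      ultimately show ?case
        unfolding norm_sq
        by (simp add: \<Phi>_def inner_prod_def e_def algebra_simps power2_eq_square)
    qed
    then show ?thesis
      using sub zU unfolding prox_subsol_def by blast
  qed
  moreover have "snd ?q' + norm (fst ?q') \<ge> P (fst w)"
  proof -
    have "\<forall>\<^sub>F y in nhds w. v y \<ge> v w + ?q' \<bullet> (y - w) - A * (norm (y - w))\<^sup>2"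
      using near[OF wU]
    proof eventually_elim
      case (elim y)
      have "\<Phi> (z, y, \<tau>) \<le> \<Phi> (z, w, \<tau>)"
        using z elim \<tau> by (rule max)
      moreover have "A * (norm (fst z - fst y))\<^sup>2 = A * (norm (fst z - fst w))\<^sup>2
          - A * (2 * (e \<bullet> (fst y - fst w))) + A * (norm (fst y - fst w))\<^sup>2"
      proof -
        have "(fst w - fst z) \<bullet> (fst y - fst w) = - (e \<bullet> (fst y - fst w))"
          by (simp add: e_def inner_diff_left)
        then have "(norm (fst z - fst y))\<^sup>2 = (norm (fst z - fst w))\<^sup>2
            - 2 * (e \<bullet> (fst y - fst w)) + (norm (fst y - fst w))\<^sup>2"
          using norm_diff_sq_expand[of "fst y" "fst z" "fst w"] by (simp add: norm_minus_commute)
        then show ?thesis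
          by (simp add: distrib_left right_diff_distrib)
      qed
      ultimately show ?case
        unfolding norm_sq
        by (simp add: \<Phi>_def inner_prod_def e_def algebra_simps power2_eq_square)
    qed
    then show ?thesis
      using super wU unfolding prox_supersol_def by blast
  qed
  \<comment> \<open>The time parts of the two test slopes differ by the slope of the penalty in \<open>\<tau>\<close>.\<close>
  moreover have "\<eta> \<le> 2 * A * (snd z - \<tau>) + 2 * A * (snd w - \<tau>)"
  proof (rule le_of_le_add_small)
    have "\<forall>\<^sub>F s in at_right (0::real). s \<in> {0<..<\<tau>}"
      using \<tau>0 by (rule eventually_at_right_real)
    then show "\<forall>\<^sub>F s in at_right 0. s * \<eta> \<le> s * (2 * A * (snd z - \<tau>) + 2 * A * (snd w - \<tau>)) + (2 * A) * s\<^sup>2"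
    proof eventually_elim
      case (elim s)
      have "\<Phi> (z, w, \<tau> - s) \<le> \<Phi> (z, w, \<tau>)"
        using elim \<tau> z w by (intro max) auto
      then show ?case
        by (simp add: \<Phi>_def algebra_simps power2_eq_square)
    qed
  qed
  moreover have "\<bar>P (fst z) - P (fst w)\<bar> < \<eta>"
    using zU wU close(1) r by (intro rP) (auto simp: inner_cylinder_def)
  ultimately show False
    by (simp add: algebra_simps)
qed

section \<open>Least Lipschitz constant and supremum norm\<close>

lemma lip_const_le: "K-lipschitz_on S h \<Longrightarrow> lip_const S h \<le> K"
  unfolding lip_const_def
  by (rule cInf_lower) (auto intro!: bdd_belowI[of _ 0] dest: lipschitz_on_nonneg)

lemma lipschitz_on_lip_const:
  assumes "lipschitz_fun_on S h"
  shows "(lip_const S h)-lipschitz_on S h"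
proof (rule lipschitz_onI)
  have ne: "{L. L-lipschitz_on S h} \<noteq> {}"
    using assms by (auto simp: lipschitz_fun_on_def)
  show "0 \<le> lip_const S h"
    unfolding lip_const_def using ne by (rule cInf_greatest) (auto dest: lipschitz_on_nonneg)
  fix x y
  assume xy: "x \<in> S" "y \<in> S"
  show "dist (h x) (h y) \<le> lip_const S h * dist x y"
  proof (cases "x = y")
    case False
    have "dist (h x) (h y) / dist x y \<le> lip_const S h"
      unfolding lip_const_def using ne
      by (rule cInf_greatest) (use xy False in \<open>auto simp: divide_le_eq dest: lipschitz_onD\<close>)
    then show ?thesis
      using False by (simp add: divide_le_eq)
  qed simp
qed

lemma sup_norm_on_upper:
  assumes "bounded (h ` S)"
  shows "x \<in> S \<Longrightarrow> \<bar>h x\<bar> \<le> sup_norm_on S h" and "0 \<le> sup_norm_on S h"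
proof -
  obtain B where "\<And>x. x \<in> S \<Longrightarrow> \<bar>h x\<bar> \<le> B"
    using assms by (auto simp: bounded_iff)
  then have bdd: "bdd_above (insert 0 ((\<lambda>x. \<bar>h x\<bar>) ` S))"
    by (auto intro!: bdd_aboveI[of _ B])
  show "x \<in> S \<Longrightarrow> \<bar>h x\<bar> \<le> sup_norm_on S h" "0 \<le> sup_norm_on S h"
    unfolding sup_norm_on_def by (rule cSup_upper[OF _ bdd]; simp)+
qed

section \<open>Time and space estimates\<close>

text \<open>Formally \<open>u\<^sub>t + |\<nabla>u| = - L + |\<nabla>\<psi>| \<le> 0 \<le> P\<close>. Without differentiability: \<open>u\<close> does not decrease
  when one moves with unit speed against the gradient of the test function while going back in
  time, and the test function has slope \<open>- (snd q + |fst q|)\<close> in that direction.\<close>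

lemma prox_subsol_initial_minus_time:
  fixes \<psi> :: "'a::real_inner \<Rightarrow> real"
  assumes "L-lipschitz_on \<Omega> \<psi>" "open (\<Omega> - \<Gamma>)" "\<And>x. x \<in> \<Omega> - \<Gamma> \<Longrightarrow> 0 \<le> P x"
  shows "prox_subsol (inner_cylinder \<Omega> \<Gamma> T) P (\<lambda>(x, t). \<psi> x - L * t)"
  unfolding prox_subsol_def
proof (intro ballI allI impI)
  fix z q C
  let ?u = "\<lambda>(x, t). \<psi> x - L * t"
  assume z: "z \<in> inner_cylinder \<Omega> \<Gamma> T"
    and ev: "\<forall>\<^sub>F w in nhds z. ?u w \<le> ?u z + q \<bullet> (w - z) + C * (norm (w - z))\<^sup>2"
  let ?d = "- (sgn (fst q), 1::real)"
  have "((\<lambda>s. fst z - s *\<^sub>R sgn (fst q)) \<longlongrightarrow> fst z) (at_right 0)"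
    by (rule tendsto_eq_intros refl | simp)+
  then have "\<forall>\<^sub>F s in at_right (0::real). fst z - s *\<^sub>R sgn (fst q) \<in> \<Omega> - \<Gamma>"
    using z by (intro topological_tendstoD assms(2)) (auto simp: inner_cylinder_def)
  moreover have "\<forall>\<^sub>F s in at_right (0::real). s > 0"
    by (simp add: eventually_at_right_less)
  ultimately have "\<forall>\<^sub>F s in at_right 0. ?u z + s * 0 \<le> ?u (z + s *\<^sub>R ?d)"
  proof eventually_elim
    case (elim s)
    have "\<bar>\<psi> (fst z) - \<psi> (fst z - s *\<^sub>R sgn (fst q))\<bar> \<le> L * norm (s *\<^sub>R sgn (fst q))"
      using lipschitz_onD[OF assms(1), of "fst z" "fst z - s *\<^sub>R sgn (fst q)"] elim z
      by (auto simp: inner_cylinder_def dist_norm)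
    also have "\<dots> \<le> L * s"
      using elim lipschitz_on_nonneg[OF assms(1)] by (intro mult_left_mono) (auto simp: norm_sgn)
    finally show ?case
      by (simp add: case_prod_beta algebra_simps)
  qed
  from quadratic_test_slope[OF ev this] have "0 \<le> q \<bullet> ?d" .
  moreover have "fst q \<bullet> sgn (fst q) = norm (fst q)"
    by (cases "fst q = 0") (simp_all add: sgn_div_norm dot_square_norm power2_eq_square)
  ultimately have "snd q + norm (fst q) \<le> 0"
    by (simp add: inner_prod_def)
  also have "0 \<le> P (fst z)"
    using z assms(3) by (auto simp: inner_cylinder_def)
  finally show "snd q + norm (fst q) \<le> P (fst z)" .
qed

lemma prox_supersol_time_shift:
  fixes v :: "'a::real_inner \<times> real \<Rightarrow> real"
  assumes "prox_supersol (inner_cylinder \<Omega> \<Gamma> T) P v" "0 \<le> h"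
  shows "prox_supersol (inner_cylinder \<Omega> \<Gamma> (T - h)) P (\<lambda>z. v (z + (0, h)))"
  unfolding prox_supersol_def
proof (intro ballI allI impI)
  fix z q C
  let ?h = "(0, h) :: 'a \<times> real"
  assume z: "z \<in> inner_cylinder \<Omega> \<Gamma> (T - h)"
    and "\<forall>\<^sub>F w in nhds z. v (z + ?h) + q \<bullet> (w - z) - C * (norm (w - z))\<^sup>2 \<le> v (w + ?h)"
  moreover have "((\<lambda>w. w - ?h) \<longlongrightarrow> (z + ?h) - ?h) (nhds (z + ?h))"
    by (intro tendsto_intros filterlim_ident)
  ultimately have "\<forall>\<^sub>F w in nhds (z + ?h). v (z + ?h) + q \<bullet> (w - ?h - z) - C * (norm (w - ?h - z))\<^sup>2 \<le> v (w - ?h + ?h)"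
    by (auto simp: filterlim_iff)
  then have "\<forall>\<^sub>F w in nhds (z + ?h). v (z + ?h) + q \<bullet> (w - (z + ?h)) - C * (norm (w - (z + ?h)))\<^sup>2 \<le> v w"
    by (simp add: algebra_simps)
  moreover have "z + ?h \<in> inner_cylinder \<Omega> \<Gamma> T"
    using z assms(2) by (auto simp: inner_cylinder_def)
  ultimately show "snd q + norm (fst q) \<ge> P (fst z)"
    using assms(1) unfolding prox_supersol_def by fastforce
qed

lemma prox_subsol_shrink:
  assumes "prox_subsol V P u" "U \<subseteq> V"
  shows "prox_subsol U P u"
  using assms unfolding prox_subsol_def by blast

text \<open>Comparison with \<open>\<psi> - L t\<close> gives the bound for \<open>s = 0\<close>. As \<open>P\<close> and the data on \<open>\<Gamma>\<close> do not depend
  on time, \<open>f\<close> shifted by \<open>h = t - s\<close> is a super-solution with the same data on \<open>\<Gamma>\<close> and with initial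
  values at least \<open>\<psi> - L h\<close>; a second comparison propagates that bound to all times.\<close>

lemma solution_time_lower_bound:
  fixes f :: "'a::euclidean_space \<times> real \<Rightarrow> real"
  assumes \<Omega>: "compact \<Omega>" "\<Gamma> \<subseteq> \<Omega>" "open (\<Omega> - \<Gamma>)"
    and P: "\<And>x. x \<in> \<Omega> - \<Gamma> \<Longrightarrow> 0 \<le> P x" "uniformly_continuous_on (\<Omega> - \<Gamma>) P"
    and \<psi>: "L-lipschitz_on \<Omega> \<psi>"
    and cont: "continuous_on (cylinder \<Omega> T) f"
    and sub: "prox_subsol (inner_cylinder \<Omega> \<Gamma> T) P f"
    and super: "prox_supersol (inner_cylinder \<Omega> \<Gamma> T) P f"
    and init: "\<And>x. x \<in> \<Omega> \<Longrightarrow> f (x, 0) = \<psi> x"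
    and side: "\<And>x t. x \<in> \<Gamma> \<Longrightarrow> t \<in> {0..T} \<Longrightarrow> f (x, t) = \<psi> x"
    and "x \<in> \<Omega>" "0 \<le> s" "s \<le> t" "t < T"
  shows "f (x, s) \<le> f (x, t) + L * (t - s)"
proof -
  have L: "0 \<le> L"
    using \<psi> by (rule lipschitz_on_nonneg)
  have from_0: "\<psi> x - L * t \<le> f (x, t)" if "x \<in> \<Omega>" "t \<in> {0..<T}" for x t
  proof -
    have "continuous_on (cylinder \<Omega> T) (\<lambda>(x, t). \<psi> x - L * t)"
      unfolding case_prod_beta cylinder_def
      by (intro continuous_intros continuous_on_compose2[OF lipschitz_on_continuous_on[OF \<psi>]]) auto
    then have "(case (x, t) of (x, t) \<Rightarrow> \<psi> x - L * t) \<le> f (x, t) + 0"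
      by (rule comparison_principle[OF \<Omega>(1,3) _ cont P(2)
            prox_subsol_initial_minus_time[OF \<psi> \<Omega>(3) P(1)] super _ _ that])
        (use init side L in auto)
    then show ?thesis by simp
  qed
  define h where "h = t - s"
  have h: "0 \<le> h" "h < T" "s \<in> {0..<T - h}"
    using assms by (auto simp: h_def)
  have "f (x, s) \<le> f ((x, s) + (0, h)) + L * h"
  proof (rule comparison_principle[OF \<Omega>(1,3) _ _ P(2) _ prox_supersol_time_shift[OF super h(1)]
        _ _ \<open>x \<in> \<Omega>\<close> h(3)])
    show "continuous_on (cylinder \<Omega> (T - h)) f"
      using cont by (rule continuous_on_subset) (use h in \<open>auto simp: cylinder_def\<close>)
    show "continuous_on (cylinder \<Omega> (T - h)) (\<lambda>z. f (z + (0, h)))"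
      by (rule continuous_on_compose2[OF cont])
        (use h in \<open>auto simp: cylinder_def intro!: continuous_intros\<close>)
    show "prox_subsol (inner_cylinder \<Omega> \<Gamma> (T - h)) P f"
      using sub by (rule prox_subsol_shrink) (use h in \<open>auto simp: inner_cylinder_def\<close>)
    show "f (x, 0) \<le> f ((x, 0) + (0, h)) + L * h" if "x \<in> \<Omega>" for x
      using from_0[OF that, of h] init[OF that] h by simp
    show "f (x, t) \<le> f ((x, t) + (0, h)) + L * h" if "x \<in> \<Gamma>" "t \<in> {0..T - h}" for x t
      using side[OF that(1), of t] side[OF that(1), of "t + h"] that(2) h L by simp
  qed
  then show ?thesis
    by (simp add: h_def)
qed

theorem theorem2p8:
  fixes \<Omega> \<Gamma> \<N> :: "(real ^ 'm) set"
    and P \<psi> \<psi>\<^sub>b :: "real ^ 'm \<Rightarrow> real"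
    and T a\<^sub>0 d\<^sub>0 :: real
    and f :: "(real ^ 'm) \<times> real \<Rightarrow> real"
  assumes "T > 0"
    and "compact \<Omega>"
    and "\<Gamma> \<subseteq> \<Omega>" and "closed \<Gamma>" and "open (\<Omega> - \<Gamma>)"
    and "\<And>x. x \<in> \<Omega> - \<Gamma> \<Longrightarrow> P x \<ge> 0"
    and "lipschitz_fun_on (\<Omega> - \<Gamma>) P"
    and "lipschitz_fun_on \<Omega> \<psi>"
    and "a\<^sub>0 > 0" and "d\<^sub>0 > 0"
    and "\<N> = {x \<in> \<Omega>. infdist x \<Gamma> < a\<^sub>0}"
    and "C1_on (\<N> - \<Gamma>) (\<lambda>x. infdist x \<Gamma>)"
    and "\<And>x. x \<in> \<N> - \<Gamma> \<Longrightarrow> norm (grad (\<lambda>y. infdist y \<Gamma>) x) \<ge> d\<^sub>0"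
    and "lipschitz_fun_on \<Omega> \<psi>\<^sub>b"
    and "\<And>x. x \<in> \<Gamma> \<Longrightarrow> \<psi>\<^sub>b x = \<psi> x"
    and "visc_subsol \<Omega> \<Gamma> T P \<psi> (\<lambda>(x, t). \<psi>\<^sub>b x)"
    and "continuous_on (cylinder \<Omega> T) f"
    and "visc_solution \<Omega> \<Gamma> T P \<psi> f"
  shows "(\<forall>x\<in>\<Omega>. lipschitz_fun_on {0..<T} (\<lambda>t. f (x, t)) \<and>
            lip_const {0..<T} (\<lambda>t. f (x, t)) \<le> sup_norm_on (\<Omega> - \<Gamma>) P + lip_const \<Omega> \<psi>)
       \<and> (\<forall>t\<in>{0..T}. lipschitz_fun_on \<Omega> (\<lambda>x. f (x, t)) \<and>
            lip_const \<Omega> (\<lambda>x. f (x, t)) \<le> 2 * sup_norm_on (\<Omega> - \<Gamma>) P + lip_const \<Omega> \<psi>)"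
proof -
  note \<Omega> = assms(2,3,5)
  define L where "L = lip_const \<Omega> \<psi>"
  define M where "M = sup_norm_on (\<Omega> - \<Gamma>) P"
  have \<psi>: "L-lipschitz_on \<Omega> \<psi>"
    unfolding L_def using assms(8) by (rule lipschitz_on_lip_const)
  have P_uc: "uniformly_continuous_on (\<Omega> - \<Gamma>) P"
    using assms(7) by (auto simp: lipschitz_fun_on_def intro: lipschitz_on_uniformly_continuous)
  have "bounded (P ` (\<Omega> - \<Gamma>))"
    using P_uc bounded_subset[OF compact_imp_bounded[OF assms(2)]]
    by (rule bounded_uniformly_continuous_image) auto
  note P_bound = sup_norm_on_upper[OF this, folded M_def]
  let ?U = "inner_cylinder \<Omega> \<Gamma> T"
  note sub = visc_solution_imp_prox(1)[OF assms(18,17)]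
    and super = visc_solution_imp_prox(2)[OF assms(18,17)]
    and init = visc_solution_boundary(1)[OF assms(18,17,1,3)]
    and side = visc_solution_boundary(2)[OF assms(18,17,1,3)]
  have lower: "f (x, s) \<le> f (x, t) + L * (t - s)" if "x \<in> \<Omega>" "0 \<le> s" "s \<le> t" "t < T" for x s t
    by (rule solution_time_lower_bound[OF \<Omega> assms(6) P_uc \<psi> assms(17) sub super init side])
      (use that in auto)
  have U: "open ?U"
    unfolding inner_cylinder_def using assms(5) by (intro open_Times) auto
  have f_U: "continuous_on ?U f"
    using assms(17) by (rule continuous_on_subset) (auto simp: inner_cylinder_def cylinder_def)
  have nonneg: "0 \<le> L" "0 \<le> M"
    using \<psi> P_bound(2) by (auto dest: lipschitz_on_nonneg)

  \<comment> \<open>The equation bounds \<open>f\<^sub>t\<close> from above by \<open>M\<close>; with \<open>f\<^sub>t \<ge> - L\<close> it bounds \<open>|\<nabla>f|\<close> by \<open>M + L\<close>.\<close>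
  have test_time: "snd q \<le> M" and test_space: "norm (fst q) \<le> M + L"
    if z: "z \<in> ?U" and ev: "\<forall>\<^sub>F w in nhds z. f w \<le> f z + q \<bullet> (w - z) + C * (norm (w - z))\<^sup>2" for z q C
  proof -
    have "snd q + norm (fst q) \<le> P (fst z)"
      using sub that unfolding prox_subsol_def by blast
    also have "P (fst z) \<le> M"
      using P_bound(1)[of "fst z"] z by (auto simp: inner_cylinder_def)
    finally have *: "snd q + norm (fst q) \<le> M" .
    then show "snd q \<le> M"
      using norm_ge_zero[of "fst q"] by linarith
    have "\<forall>\<^sub>F s in at_right (0::real). s \<in> {0<..<T - snd z}"
      using z by (intro eventually_at_right_real) (auto simp: inner_cylinder_def)
    then have "\<forall>\<^sub>F s in at_right 0. f z + s * (- L) \<le> f (z + s *\<^sub>R (0, 1))"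
    proof eventually_elim
      case (elim s)
      then show ?case
        using lower[of "fst z" "snd z" "snd z + s"] z
        by (cases z) (auto simp: inner_cylinder_def mult.commute)
    qed
    from quadratic_test_slope[OF ev this] have "- L \<le> snd q"
      by (simp add: inner_prod_def)
    with * show "norm (fst q) \<le> M + L"
      by linarith
  qed

  have time: "(M + L)-lipschitz_on {0..T} (\<lambda>t. f (x, t))" if x: "x \<in> \<Omega>" for x
  proof -
    have upper: "f (x, t) \<le> f (x, s) + M * (t - s)" if st: "0 < s" "s \<le> t" "t < T" for s t
    proof (cases "x \<in> \<Gamma>")
      case True
      then show ?thesis
        using side[of x s] side[of x t] st nonneg by simp
    next
      case False
      show ?thesis
      proof (rule directional_growth_bound[OF U f_U])
        have "convex ({x} \<times> {s..t})" "{x} \<times> {s..t} \<subseteq> ?U"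
          using st x False by (auto simp: inner_cylinder_def intro!: convex_Times)
        then show "closed_segment (x, s) (x, t) \<subseteq> ?U"
          using closed_segment_subset[of "(x, s)" "{x} \<times> {s..t}" "(x, t)"] st by auto
        show "q \<bullet> ((x, t) - (x, s)) \<le> M * (t - s)"
          if "z \<in> ?U" "\<forall>\<^sub>F w in nhds z. f w \<le> f z + q \<bullet> (w - z) + C * (norm (w - z))\<^sup>2" for z q C
          using test_time[OF that] st by (simp add: inner_prod_def mult_right_mono)
      qed
    qed
    have "(M + L)-lipschitz_on {0<..<T} (\<lambda>t. f (x, t))"
    proof (rule lipschitz_on_leI)
      fix s t
      assume "s \<in> {0<..<T}" "t \<in> {0<..<T}" "s \<le> t"
      then show "dist (f (x, s)) (f (x, t)) \<le> (M + L) * dist s t"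
        using upper[of s t] lower[OF x, of s t] nonneg
          mult_nonneg_nonneg[of L "t - s"] mult_nonneg_nonneg[of M "t - s"]
        by (auto simp: dist_real_def algebra_simps)
    qed (use nonneg in simp)
    moreover have "continuous_on {0..T} (\<lambda>t. f (x, t))"
      by (rule continuous_on_compose2[OF assms(17)])
        (use x in \<open>auto simp: cylinder_def intro!: continuous_intros\<close>)
    ultimately show ?thesis
      using lipschitz_on_closure[of "M + L" "{0<..<T}" "\<lambda>t. f (x, t)"] assms(1) by simp
  qed

  have space: "(M + L)-lipschitz_on \<Omega> (\<lambda>x. f (x, t))" if t: "t \<in> {0<..<T}" for t
  proof (rule lipschitz_on_glue_convex[OF assms(4,3) compact_imp_closed[OF assms(2)] assms(5)])
    show "continuous_on \<Omega> (\<lambda>x. f (x, t))"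
      by (rule continuous_on_compose2[OF assms(17)])
        (use t in \<open>auto simp: cylinder_def intro!: continuous_intros\<close>)
    have "(M + L)-lipschitz_on \<Gamma> \<psi>"
      using \<psi> assms(3) by (rule lipschitz_on_mono) (use nonneg in simp)
    then show "(M + L)-lipschitz_on \<Gamma> (\<lambda>x. f (x, t))"
      by (rule lipschitz_on_transform) (use side t in auto)
  next
    fix C
    assume C: "convex C" "C \<subseteq> \<Omega> - \<Gamma>"
    have "f (y, t) \<le> f (x, t) + (M + L) * norm (y - x)" if xy: "x \<in> C" "y \<in> C" for x y
    proof (rule directional_growth_bound[OF U f_U])
      have "convex (C \<times> {t})" "C \<times> {t} \<subseteq> ?U"
        using C t by (auto simp: inner_cylinder_def intro!: convex_Times)
      then show "closed_segment (x, t) (y, t) \<subseteq> ?U"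
        using closed_segment_subset[of "(x, t)" "C \<times> {t}" "(y, t)"] xy by auto
      show "q \<bullet> ((y, t) - (x, t)) \<le> (M + L) * norm (y - x)"
        if "z \<in> ?U" "\<forall>\<^sub>F w in nhds z. f w \<le> f z + q \<bullet> (w - z) + D * (norm (w - z))\<^sup>2" for z q D
      proof -
        have "fst q \<bullet> (y - x) \<le> norm (fst q) * norm (y - x)"
          by (rule norm_cauchy_schwarz)
        also have "\<dots> \<le> (M + L) * norm (y - x)"
          using test_space[OF that] by (rule mult_right_mono) simp
        finally show ?thesis
          by (simp add: inner_prod_def)
      qed
    qed
    from this show "(M + L)-lipschitz_on C (\<lambda>x. f (x, t))"
      using nonneg by (intro lipschitz_onI) (fastforce simp: dist_norm norm_minus_commute abs_le_iff)+
  qed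

  \<comment> \<open>Nothing can be tested at \<open>t = 0\<close> and \<open>t = T\<close>; there the bound is a limit.\<close>
  have space_all: "(M + L)-lipschitz_on \<Omega> (\<lambda>x. f (x, t))" if t: "t \<in> {0..T}" for t
  proof (rule lipschitz_onI)
    fix x y
    assume xy: "x \<in> \<Omega>" "y \<in> \<Omega>"
    have "continuous_on (closure {0<..<T}) (\<lambda>t. dist (f (x, t)) (f (y, t)))"
      using xy assms(1) lipschitz_on_continuous_on[OF time] by (auto intro!: continuous_intros)
    then show "dist (f (x, t)) (f (y, t)) \<le> (M + L) * dist x y"
      by (rule continuous_le_on_closure) (use t assms(1) lipschitz_onD[OF space] xy in auto)
  qed (use nonneg in simp)

  have "(M + L)-lipschitz_on {0..<T} (\<lambda>t. f (x, t))" if "x \<in> \<Omega>" for x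
    using time[OF that] by (rule lipschitz_on_subset) auto
  moreover have "(2 * M + L)-lipschitz_on \<Omega> (\<lambda>x. f (x, t))" if "t \<in> {0..T}" for t
    using space_all[OF that] by (rule lipschitz_on_mono) (use nonneg in auto)
  ultimately show ?thesis
    unfolding lipschitz_fun_on_def L_def[symmetric] M_def[symmetric]
    by (blast intro: lip_const_le)
qed

end
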